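(* Let $n\ge 22$ be an integer. Define a process $X_0,X_1,\ldots$ on $\mathbb{Z}_n$ (the integers mod $n$) by $X_0=0$, $X_1=1$ and $$X_{k+1}=X_k+X_{k-1}+\epsilon_{k+1}\pmod n\qquad (k\ge 1),$$ where the $\epsilon_i$ are independent, each taking the values $0$, $1$ and $-1$ with equal probabilities. Let $P_k(j)=\mathbb{P}(X_k=j)$ and $U(j)=1/n$ for $j\in\mathbb{Z}_n$. Then for every real number $c$ such that $k=5\bigl((\log n)^2+c\log n\bigr)$ is a positive integer, $$\|P_k-U\|_{TV}\le 1.6\,e^{-c/2}.$$
   Context: $\log$ is the natural logarithm. Total variation distance: $\|P_k-U\|_{TV}=\frac12\sum_{j\in\mathbb{Z}_n}|P_k(j)-U(j)|$. *)

theory Defs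
  imports "HOL-Probability.Probability"
begin

text \<open>
  The group \<open>\<int>\<^sub>n\<close> is represented by the residues \<open>{0..<int n}\<close>. Only the noise terms with
  index \<open>i \<ge> 2\<close> enter the recursion.
\<close>

fun fib_process :: "nat \<Rightarrow> (nat \<Rightarrow> 'a \<Rightarrow> int) \<Rightarrow> nat \<Rightarrow> 'a \<Rightarrow> int" where
  "fib_process n \<epsilon> 0 \<omega> = 0 mod int n"
| "fib_process n \<epsilon> (Suc 0) \<omega> = 1 mod int n"
| "fib_process n \<epsilon> (Suc (Suc k)) \<omega> =
     (fib_process n \<epsilon> (Suc k) \<omega> + fib_process n \<epsilon> k \<omega> + \<epsilon> (Suc (Suc k)) \<omega>) mod int n"

definition fib_law :: "'a measure \<Rightarrow> nat \<Rightarrow> (nat \<Rightarrow> 'a \<Rightarrow> int) \<Rightarrow> nat \<Rightarrow> int \<Rightarrow> real" where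
  "fib_law M n \<epsilon> k j = \<P>(\<omega> in M. fib_process n \<epsilon> k \<omega> = j)"

definition unif_law :: "nat \<Rightarrow> int \<Rightarrow> real" where
  "unif_law n j = 1 / real n"

definition tv_dist :: "nat \<Rightarrow> (int \<Rightarrow> real) \<Rightarrow> (int \<Rightarrow> real) \<Rightarrow> real" where
  "tv_dist n P Q = (1 / 2) * (\<Sum>j\<in>{0..<int n}. \<bar>P j - Q j\<bar>)"

end

theory Submission
  imports Defs "HOL-Number_Theory.Fib"
begin

text \<open>
  Unrolling the recursion gives \<open>X\<^sub>k = F\<^sub>k + \<Sum> F\<^sub>m \<epsilon>\<^sub>k\<^sub>+\<^sub>1\<^sub>-\<^sub>m\<close> modulo \<open>n\<close>, the sum running over \<open>1 \<le> m < k\<close>,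
  where \<open>F\<close> is the Fibonacci sequence. By independence the Fourier coefficient of the law at
  frequency \<open>a\<close> therefore has absolute value \<open>\<Prod> \<bar>1 + 2 cos (2\<pi> a F\<^sub>m / n)\<bar> / 3\<close>
  (lemma \<open>fib_law_add_char\<close>). Every factor is at most \<open>1\<close>, and a factor is at most \<open>1/3\<close> as soon
  as the residue of \<open>a F\<^sub>m\<close> of least absolute value is at least \<open>n/3\<close> in absolute value.

  The heart of the proof is that for \<open>0 < a < n\<close> such an \<open>m\<close> occurs among any \<open>4 i + 2\<close>
  consecutive indices if \<open>n \<le> 2^i\<close> (lemma \<open>fib_window_large_residue\<close>). Suppose not. Then the
  balanced residues \<open>r\<^sub>m\<close> in the window satisfy \<open>\<bar>r\<^sub>m\<^sub>+\<^sub>2 - r\<^sub>m\<^sub>+\<^sub>1 - r\<^sub>m\<bar> < n\<close>, and this number is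
  divisible by \<open>n\<close>, so the Fibonacci recursion holds for them exactly, over the integers. Such a
  sequence may shrink before it grows, but seen from the middle it must grow in at least one
  direction: the sums \<open>r\<^sub>m\<^sub>+\<^sub>2\<^sub>j + r\<^sub>m\<^sub>-\<^sub>2\<^sub>j\<close> at least double with each \<open>j\<close> (from \<open>j = 1\<close> on). So a nonzero
  middle term forces an end term of size at least \<open>n/2\<close>, which is a contradiction. The two middle
  terms are not both zero, because consecutive Fibonacci numbers are coprime.

  A window thus has length at most \<open>10 log n\<close>, and the \<open>k - 1\<close> factors contain at least
  \<open>N \<ge> (log n + c) / 2 - 1\<close> disjoint windows. Each nontrivial coefficient is at most \<open>3^(-N)\<close>, and
  since \<open>9 \<ge> e\<^sup>2\<close>, its square is at most \<open>9 e^(-c) / n\<close>. By Cauchy-Schwarz and Parseval,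
  the square of twice the distance is at most the sum of these \<open>n - 1\<close> squares, so the distance is
  at most \<open>(3/2) e^(-c/2)\<close>.
\<close>

section \<open>Fourier analysis on the integers modulo n\<close>

definition add_char :: "nat \<Rightarrow> nat \<Rightarrow> int \<Rightarrow> complex" where
  "add_char n a x = cis (2 * pi * real a * real_of_int x / real n)"

lemma norm_add_char [simp]: "norm (add_char n a x) = 1"
  by (simp add: add_char_def)

lemma add_char_add: "add_char n a (x + y) = add_char n a x * add_char n a y"
  by (simp add: add_char_def cis_mult add_divide_distrib ring_distribs)

lemma add_char_0_left [simp]: "add_char n 0 x = 1"
  by (simp add: add_char_def)

lemma add_char_0_right [simp]: "add_char n a 0 = 1"
  by (simp add: add_char_def)

lemma cnj_add_char: "cnj (add_char n a x) = add_char n a (- x)"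
  by (simp add: add_char_def cis_cnj)

lemma add_char_sum: "add_char n a (\<Sum>i\<in>I. f i) = (\<Prod>i\<in>I. add_char n a (f i))"
  by (induction I rule: infinite_finite_induct) (simp_all add: add_char_add)

lemma add_char_mod:
  assumes "n > 0"
  shows "add_char n a (x mod int n) = add_char n a x"
proof -
  have "add_char n a (int n * (x div int n)) = cis (2 * pi * (real a * real_of_int (x div int n)))"
    using assms by (simp add: add_char_def field_simps)
  also have "\<dots> = 1"
    by (rule cis_multiple_2pi) auto
  finally have "add_char n a (int n * (x div int n)) = 1" .
  then show ?thesis
    using add_char_add[of n a "int n * (x div int n)" "x mod int n"] by simp
qed

lemma sum_add_char:
  assumes "n > 0"
  shows "(\<Sum>a<n. add_char n a d) = (if int n dvd d then of_nat n else 0)"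
proof (cases "int n dvd d")
  case True
  then have "add_char n a d = 1" for a
    using add_char_mod[OF assms, of a d] by simp
  with True show ?thesis by simp
next
  case False
  define z where "z = cis (2 * pi * real_of_int d / real n)"
  have pow: "add_char n a d = z ^ a" for a
    by (simp add: add_char_def z_def Complex.DeMoivre mult_ac)
  have "z \<noteq> 1"
  proof
    assume "z = 1"
    then have "cos (2 * pi * real_of_int d / real n) = 1"
      by (simp add: z_def complex_eq_iff)
    then obtain m :: int where "2 * pi * real_of_int d / real n = m * 2 * pi"
      by (auto simp: cos_one_2pi_int)
    then have "real_of_int d = real_of_int (m * int n)"
      using assms by (simp add: field_simps)
    then have "d = m * int n" by (simp only: of_int_eq_iff)
    with False show False by simp
  qed
  moreover have "z ^ n = 1"
  proof -
    have "z ^ n = cis (2 * pi * real_of_int d)"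
      using assms by (simp add: z_def Complex.DeMoivre)
    also have "\<dots> = 1" by (rule cis_multiple_2pi) auto
    finally show ?thesis .
  qed
  ultimately show ?thesis
    using False geometric_sum[of z n] by (simp add: pow)
qed

text \<open>
  Expanding the squared absolute values leaves, for each pair of residues, a character sum that
  vanishes off the diagonal.
\<close>

lemma parseval_residues:
  fixes f :: "int \<Rightarrow> real"
  assumes "n > 0"
  shows "(\<Sum>a<n. (norm (\<Sum>j\<in>{0..<int n}. of_real (f j) * add_char n a j))\<^sup>2)
       = real n * (\<Sum>j\<in>{0..<int n}. (f j)\<^sup>2)"
proof -
  let ?R = "{0..<int n}"
  have "complex_of_real (\<Sum>a<n. (norm (\<Sum>j\<in>?R. of_real (f j) * add_char n a j))\<^sup>2)
      = (\<Sum>a<n. \<Sum>j\<in>?R. \<Sum>l\<in>?R. of_real (f j * f l) * add_char n a (j - l))"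
    unfolding of_real_sum complex_norm_square cnj_sum sum_product
    by (intro sum.cong refl) (simp add: cnj_add_char flip: add_char_add)
  also have "\<dots> = (\<Sum>j\<in>?R. \<Sum>a<n. \<Sum>l\<in>?R. of_real (f j * f l) * add_char n a (j - l))"
    by (rule sum.swap)
  also have "\<dots> = (\<Sum>j\<in>?R. \<Sum>l\<in>?R. \<Sum>a<n. of_real (f j * f l) * add_char n a (j - l))"
    by (intro sum.cong refl sum.swap)
  also have "\<dots> = (\<Sum>j\<in>?R. \<Sum>l\<in>?R. if j = l then of_real (f j * f l) * of_nat n else 0)"
  proof (intro sum.cong refl)
    fix j l assume "j \<in> ?R" "l \<in> ?R"
    then have "int n dvd j - l \<longleftrightarrow> j = l"
      by (metis atLeastLessThan_iff mod_eq_dvd_iff mod_pos_pos_trivial)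
    then show "(\<Sum>a<n. of_real (f j * f l) * add_char n a (j - l))
             = (if j = l then complex_of_real (f j * f l) * of_nat n else 0)"
      by (simp add: sum_add_char[OF assms] flip: sum_distrib_left)
  qed
  also have "\<dots> = complex_of_real (real n * (\<Sum>j\<in>?R. (f j)\<^sup>2))"
    by (simp add: sum_distrib_left power2_eq_square mult_ac)
  finally show ?thesis
    by (simp only: of_real_eq_iff)
qed

text \<open>
  The upper bound lemma of Diaconis and Shahshahani: by Cauchy-Schwarz the \<open>L\<^sup>1\<close> distance to
  the uniform law is controlled by the \<open>L\<^sup>2\<close> distance, which Parseval expresses through the Fourier
  coefficients. Subtracting the uniform law removes the coefficient at \<open>0\<close> and changes no other.
\<close>

lemma tv_dist_unif_fourier_bound:
  fixes P :: "int \<Rightarrow> real"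
  assumes n: "n > 0"
    and total: "(\<Sum>j\<in>{0..<int n}. P j) = 1"
    and coeff: "\<And>a. 0 < a \<Longrightarrow> a < n \<Longrightarrow>
      norm (\<Sum>j\<in>{0..<int n}. of_real (P j) * add_char n a j) \<le> \<delta>"
  shows "(2 * tv_dist n P (unif_law n))\<^sup>2 \<le> real n * \<delta>\<^sup>2"
proof -
  let ?R = "{0..<int n}"
  define f where "f j = P j - 1 / real n" for j
  have "(2 * tv_dist n P (unif_law n))\<^sup>2 = (\<Sum>j\<in>?R. \<bar>f j\<bar>)\<^sup>2"
    by (simp add: tv_dist_def unif_law_def f_def)
  also have "\<dots> \<le> (\<Sum>j\<in>?R. \<bar>f j\<bar>\<^sup>2) * card ?R"
    by (rule sum_squared_le_sum_of_squares)
  also have "\<dots> = real n * (\<Sum>j\<in>?R. (f j)\<^sup>2)"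
    by simp
  also have "\<dots> = (\<Sum>a<n. (norm (\<Sum>j\<in>?R. of_real (f j) * add_char n a j))\<^sup>2)"
    by (rule parseval_residues[OF n, symmetric])
  also have "\<dots> \<le> (\<Sum>a<n. \<delta>\<^sup>2)"
  proof (rule sum_mono)
    fix a assume "a \<in> {..<n}"
    then have a: "a < n" by simp
    show "(norm (\<Sum>j\<in>?R. of_real (f j) * add_char n a j))\<^sup>2 \<le> \<delta>\<^sup>2"
    proof (cases "a = 0")
      case True
      have "(\<Sum>j\<in>?R. f j) = 0"
        using n by (simp add: f_def sum_subtractf total)
      then have "(\<Sum>j\<in>?R. complex_of_real (f j)) = 0"
        by (simp flip: of_real_sum)
      with True show ?thesis by simp
    next
      case False
      \<comment> \<open>Frequency and residue may be exchanged, so orthogonality also applies to sums over residues.\<close>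
      have "(\<Sum>j\<in>?R. add_char n a j) = (\<Sum>j<n. add_char n j (int a))"
        by (rule sum.reindex_bij_witness[of _ int nat]) (auto simp: add_char_def mult_ac)
      also have "\<dots> = 0"
        using a False by (simp add: sum_add_char[OF n] nat_dvd_not_less)
      finally have unif: "(\<Sum>j\<in>?R. add_char n a j) = 0" .
      have "(\<Sum>j\<in>?R. of_real (f j) * add_char n a j)
          = (\<Sum>j\<in>?R. of_real (P j) * add_char n a j) - (\<Sum>j\<in>?R. add_char n a j) / of_nat n"
        by (simp add: f_def algebra_simps sum_subtractf sum_divide_distrib)
      with unif coeff[of a] a False show ?thesis
        by (simp add: power_mono)
    qed
  qed
  finally show ?thesis by simp
qed

section \<open>Fibonacci multiples modulo n\<close>

text \<open>
  Two steps of the recursion give \<open>y\<^sub>m\<^sub>+\<^sub>2 + y\<^sub>m\<^sub>-\<^sub>2 = 3 y\<^sub>m\<close>. Hence the symmetric sums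
  \<open>b\<^sub>j = y\<^sub>c\<^sub>+\<^sub>2\<^sub>j + y\<^sub>c\<^sub>-\<^sub>2\<^sub>j\<close> satisfy \<open>b\<^sub>j\<^sub>+\<^sub>2 = 3 b\<^sub>j\<^sub>+\<^sub>1 - b\<^sub>j\<close>, so once \<open>\<bar>b\<bar>\<close> is nondecreasing it at
  least doubles; and it starts with \<open>2 y\<^sub>c\<close>, \<open>3 y\<^sub>c\<close>. Using both sides of \<open>c\<close> is
  essential, because a solution can be decreasing in one direction.
\<close>

lemma fib_recurrence_outer_terms_grow:
  fixes y :: "nat \<Rightarrow> int"
  assumes rec: "\<And>t. t + 2 \<le> L \<Longrightarrow> y (t + 2) = y (t + 1) + y t"
    and c: "2 * i \<le> c" "c + 2 * i \<le> L"
  shows "2 ^ i * \<bar>y c\<bar> \<le> \<bar>y (c + 2 * i)\<bar> + \<bar>y (c - 2 * i)\<bar>"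
proof -
  define b where "b j = y (c + 2 * j) + y (c - 2 * j)" for j
  have step: "y (m + 4) = 3 * y (m + 2) - y m" if "m + 4 \<le> L" for m
    using rec[of m] rec[of "m + 1"] rec[of "m + 2"] that
    by (simp add: eval_nat_numeral)
  have b0: "b 0 = 2 * y c"
    by (simp add: b_def)
  have b1: "b 1 = 3 * y c" if "1 \<le> i"
  proof -
    have "y (c - 2 + 4) = 3 * y (c - 2 + 2) - y (c - 2)"
      using that c by (intro step) auto
    moreover have "c - 2 + 4 = c + 2" "c - 2 + 2 = c" using that c by auto
    ultimately show ?thesis by (simp add: b_def)
  qed
  have bstep: "b (j + 2) = 3 * b (j + 1) - b j" if "j + 2 \<le> i" for j
  proof -
    have add: "u + v = 3 * (p + q) - (r + t)" if "u = 3 * p - r" "t = 3 * q - v"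
      for u v p q r t :: int using that by simp
    have eqs: "c + 2 * j + 4 = c + 2 * (j + 2)" "c + 2 * j + 2 = c + 2 * (j + 1)"
      "c - 2 * (j + 2) + 4 = c - 2 * j" "c - 2 * (j + 2) + 2 = c - 2 * (j + 1)"
      using that c by auto
    have "c + 2 * j + 4 \<le> L" "c - 2 * (j + 2) + 4 \<le> L"
      using that c by auto
    then show ?thesis
      using step[of "c + 2 * j"] step[of "c - 2 * (j + 2)"] unfolding b_def eqs
      by (intro add)
  qed
  have grow: "\<bar>b j\<bar> \<le> \<bar>b (j + 1)\<bar> \<and> 2 ^ (j + 1) * \<bar>y c\<bar> \<le> \<bar>b (j + 1)\<bar>" if "j + 1 \<le> i" for j
    using that
  proof (induction j)
    case 0
    then show ?case using b0 b1 by (simp add: abs_mult)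
  next
    case (Suc j)
    then have IH: "\<bar>b j\<bar> \<le> \<bar>b (j + 1)\<bar>" "2 ^ (j + 1) * \<bar>y c\<bar> \<le> \<bar>b (j + 1)\<bar>"
      by auto
    have "b (j + 2) = 3 * b (j + 1) - b j"
      using Suc.prems by (intro bstep) simp
    then have double: "2 * \<bar>b (j + 1)\<bar> \<le> \<bar>b (j + 2)\<bar>"
      using IH(1) by linarith
    have "2 ^ (j + 2) * \<bar>y c\<bar> \<le> 2 * \<bar>b (j + 1)\<bar>"
      using IH(2) by (simp add: mult_ac)
    also note double
    finally show ?case using double by simp
  qed
  have "2 ^ i * \<bar>y c\<bar> \<le> \<bar>b i\<bar>"
  proof (cases i)
    case 0
    then show ?thesis using b0 by simp
  next
    case (Suc j)
    then show ?thesis using grow[of j] by simp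
  qed
  then show ?thesis unfolding b_def by linarith
qed

text \<open>
  The values \<open>r m\<close> may be any representatives of the residues of \<open>a F\<^sub>m\<close>. The window is long enough
  for two adjacent centres, each with \<open>2 i\<close> neighbours on either side, and one of these centres
  carries a nonzero residue.
\<close>

lemma fib_window_large_residue:
  fixes r :: "nat \<Rightarrow> int"
  assumes a: "0 < a" "a < n"
    and i: "n \<le> 2 ^ i"
    and r: "\<And>m. r m mod int n = int (a * fib m) mod int n"
  shows "\<exists>m\<in>{s..<s + (4 * i + 2)}. int n \<le> 3 * \<bar>r m\<bar>"
proof (rule ccontr)
  assume "\<not> ?thesis"
  then have small: "3 * \<bar>r m\<bar> < int n" if "s \<le> m" "m < s + (4 * i + 2)" for m
    using that by (force simp: not_le)
  have cong: "int n dvd r m - int (a * fib m)" for m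
    using r[of m] by (simp add: mod_eq_dvd_iff)
  define y where "y t = r (s + t)" for t
  \<comment> \<open>Three terms smaller than \<open>n/3\<close> leave no room for a nonzero multiple of \<open>n\<close>.\<close>
  have rec: "y (t + 2) = y (t + 1) + y t" if "t + 2 \<le> 4 * i + 1" for t
  proof -
    have "int n dvd y (t + 2) - y (t + 1) - y t"
    proof -
      have "y (t + 2) - y (t + 1) - y t
          = (r (s + t + 2) - int (a * fib (s + t + 2))) - (r (s + t + 1) - int (a * fib (s + t + 1)))
            - (r (s + t) - int (a * fib (s + t)))"
        by (simp add: y_def fib_plus_2 algebra_simps)
      then show ?thesis
        by (simp only:) (intro dvd_diff cong)
    qed
    moreover have "\<bar>y (t + 2) - y (t + 1) - y t\<bar> < int n"
      using small[of "s + (t + 2)"] small[of "s + (t + 1)"] small[of "s + t"] that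
      unfolding y_def by linarith
    ultimately have "y (t + 2) - y (t + 1) - y t = 0"
      by (metis dvd_imp_le_int abs_of_nat linorder_not_le)
    then show ?thesis by simp
  qed
  have zero: "y c = 0" if "c = 2 * i \<or> c = 2 * i + 1" for c
  proof (rule ccontr)
    assume "y c \<noteq> 0"
    have "2 ^ i * \<bar>y c\<bar> \<le> \<bar>y (c + 2 * i)\<bar> + \<bar>y (c - 2 * i)\<bar>"
      using rec that by (intro fib_recurrence_outer_terms_grow[of "4 * i + 1"]) auto
    moreover have "3 * \<bar>y (c + 2 * i)\<bar> < int n" "3 * \<bar>y (c - 2 * i)\<bar> < int n"
      using that unfolding y_def by (auto intro!: small)
    moreover have "int n \<le> 2 ^ i * \<bar>y c\<bar>"
    proof -
      have "int n \<le> 2 ^ i" using i by (metis of_nat_le_iff of_nat_numeral of_nat_power)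
      also have "\<dots> \<le> 2 ^ i * \<bar>y c\<bar>" using \<open>y c \<noteq> 0\<close> by simp
      finally show ?thesis .
    qed
    ultimately show False by linarith
  qed
  define p where "p = s + 2 * i"
  have "r p = 0" "r (Suc p) = 0"
    using zero[of "2 * i"] zero[of "2 * i + 1"] by (simp_all add: y_def p_def)
  then have "n dvd a * fib p" "n dvd a * fib (Suc p)"
    using cong[of p] cong[of "Suc p"] by (simp_all only: diff_0 dvd_minus_iff int_dvd_int_iff)
  then have "n dvd gcd (a * fib p) (a * fib (Suc p))"
    by (rule gcd_greatest)
  also have "gcd (a * fib p) (a * fib (Suc p)) = a"
    using coprime_fib_Suc_nat[of p] by (simp add: gcd_mult_distrib_nat[symmetric] coprime_iff_gcd_eq_1)
  finally show False using a by (simp add: nat_dvd_not_less)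
qed

text \<open>
  The Fourier transform, at frequency \<open>a x\<close>, of the uniform law on \<open>{0, 1, -1}\<close>.
\<close>

definition noise_factor :: "nat \<Rightarrow> nat \<Rightarrow> int \<Rightarrow> real" where
  "noise_factor n a x = (1 + 2 * cos (2 * pi * real a * real_of_int x / real n)) / 3"

lemma abs_noise_factor_le_1: "\<bar>noise_factor n a x\<bar> \<le> 1"
proof -
  have "\<bar>(1 + 2 * t) / 3\<bar> \<le> 1" if "- 1 \<le> t" "t \<le> 1" for t :: real
    using that by (simp add: abs_le_iff)
  then show ?thesis
    unfolding noise_factor_def by simp
qed

lemma cos_le_minus_half_far_residue:
  assumes "n > 0" "int n \<le> 3 * \<bar>r\<bar>" "2 * \<bar>r\<bar> \<le> int n"
  shows "cos (2 * pi * real_of_int r / real n) \<le> - 1 / 2"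
proof -
  have "real n \<le> 3 * \<bar>real_of_int r\<bar>" using assms(2) by linarith
  moreover have "2 * \<bar>real_of_int r\<bar> \<le> real n" using assms(3) by linarith
  ultimately have t: "2 * pi / 3 \<le> \<bar>2 * pi * real_of_int r / real n\<bar>"
    "\<bar>2 * pi * real_of_int r / real n\<bar> \<le> pi"
    using assms(1) by (simp_all add: abs_mult field_simps)
  have "cos (2 * pi * real_of_int r / real n) = cos \<bar>2 * pi * real_of_int r / real n\<bar>"
    by (rule cos_abs_real[symmetric])
  also have "\<dots> \<le> cos (2 * pi / 3)"
    using t by (intro cos_monotone_0_pi_le) auto
  also have "\<dots> = - 1 / 2"
    by (simp add: cos_120)
  finally show ?thesis .
qed

lemma fib_window_noise_factor:
  assumes a: "0 < a" "a < n" and i: "n \<le> 2 ^ i"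
  shows "\<exists>m\<in>{s..<s + (4 * i + 2)}. \<bar>noise_factor n a (int (fib m))\<bar> \<le> 1 / 3"
proof -
  have n: "n > 0" using a by simp
  \<comment> \<open>Shifting by half the modulus selects the representative of least absolute value.\<close>
  define h where "h = int n div 2"
  define r where "r m = (int (a * fib m) + h) mod int n - h" for m
  have r: "r m mod int n = int (a * fib m) mod int n" for m
    by (simp add: r_def mod_diff_left_eq)
  have bal: "2 * \<bar>r m\<bar> \<le> int n" for m
  proof -
    define q where "q = (int (a * fib m) + h) mod int n"
    have "0 \<le> q" "q < int n"
      using n by (simp_all add: q_def)
    moreover have "2 * h \<le> int n" "int n \<le> 2 * h + 1" unfolding h_def by linarith+
    ultimately have "2 * (q - h) \<le> int n" "2 * (h - q) \<le> int n" by presburger+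
    then show ?thesis unfolding r_def q_def[symmetric] by (simp add: abs_if)
  qed
  obtain m where m: "m \<in> {s..<s + (4 * i + 2)}" "int n \<le> 3 * \<bar>r m\<bar>"
    using fib_window_large_residue[OF a i r] by blast
  have "add_char n a (int (fib m)) = add_char n 1 (int (a * fib m))"
    by (simp add: add_char_def mult_ac)
  also have "\<dots> = add_char n 1 (r m)"
    by (metis add_char_mod[OF n] r)
  finally have "cos (2 * pi * real a * real_of_int (int (fib m)) / real n)
      = cos (2 * pi * real_of_int (r m) / real n)"
    by (simp add: add_char_def complex_eq_iff)
  moreover have "\<bar>(1 + 2 * t) / 3\<bar> \<le> 1 / 3" if "- 1 \<le> t" "t \<le> - 1 / 2" for t :: real
    using that by (simp add: abs_le_iff)
  ultimately have "\<bar>noise_factor n a (int (fib m))\<bar> \<le> 1 / 3"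
    unfolding noise_factor_def
    using cos_le_minus_half_far_residue[OF n m(2) bal] cos_ge_minus_one by presburger
  with m(1) show ?thesis by blast
qed

lemma prod_le_power_windows:
  fixes g :: "nat \<Rightarrow> real"
  assumes g: "\<And>m. 0 \<le> g m" "\<And>m. g m \<le> 1"
    and w: "\<And>s. \<exists>m\<in>{s..<s + W}. g m \<le> q"
    and len: "s + N * W \<le> e"
  shows "(\<Prod>m\<in>{s..<e}. g m) \<le> q ^ N"
  using len
proof (induction N arbitrary: s)
  case 0
  then show ?case by (simp add: prod_le_1 g)
next
  case (Suc N)
  obtain m where m: "m \<in> {s..<s + W}" "g m \<le> q" using w by blast
  have q: "0 \<le> q" using g(1)[of m] m(2) by linarith
  have "(\<Prod>m\<in>{s..<s + W}. g m) = g m * (\<Prod>m\<in>{s..<s + W} - {m}. g m)"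
    using m(1) by (intro prod.remove) auto
  also have "\<dots> \<le> q * 1"
    using q m(2) g by (intro mult_mono prod_le_1 prod_nonneg) auto
  finally have first: "(\<Prod>m\<in>{s..<s + W}. g m) \<le> q" by simp
  have "(\<Prod>m\<in>{s..<e}. g m) = (\<Prod>m\<in>{s..<s + W}. g m) * (\<Prod>m\<in>{s + W..<e}. g m)"
    using Suc.prems by (intro prod.atLeastLessThan_concat[symmetric]) auto
  also have "\<dots> \<le> q * q ^ N"
    using first q g Suc.prems by (intro mult_mono Suc.IH prod_nonneg) auto
  finally show ?case by simp
qed

section \<open>The law of the process\<close>

text \<open>
  The recursion is linear, so a noise term entering at time \<open>i\<close> is carried forward in the way the
  initial value \<open>X\<^sub>1 = 1\<close> is from time \<open>1\<close>: after \<open>k - i\<close> further steps its weight is \<open>F\<^sub>k\<^sub>+\<^sub>1\<^sub>-\<^sub>i\<close>.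
\<close>

lemma fib_process_explicit:
  "fib_process n \<epsilon> k \<omega>
    = (int (fib k) + (\<Sum>i\<in>{2..k}. int (fib (k + 1 - i)) * \<epsilon> i \<omega>)) mod int n"
proof (induction k rule: fib.induct)
  case (3 k)
  define S where "S l = int (fib l) + (\<Sum>i\<in>{2..l}. int (fib (l + 1 - i)) * \<epsilon> i \<omega>)" for l
  have "(\<Sum>i\<in>{2..Suc (Suc k)}. int (fib (Suc (Suc k) + 1 - i)) * \<epsilon> i \<omega>)
      = (\<Sum>i\<in>{2..Suc k}. int (fib (Suc (Suc k) + 1 - i)) * \<epsilon> i \<omega>) + \<epsilon> (Suc (Suc k)) \<omega>"
    by (simp add: sum.nat_ivl_Suc')
  also have "(\<Sum>i\<in>{2..Suc k}. int (fib (Suc (Suc k) + 1 - i)) * \<epsilon> i \<omega>)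
      = (\<Sum>i\<in>{2..Suc k}. int (fib (Suc k + 1 - i)) * \<epsilon> i \<omega>)
        + (\<Sum>i\<in>{2..Suc k}. int (fib (k + 1 - i)) * \<epsilon> i \<omega>)"
    unfolding sum.distrib[symmetric]
  proof (intro sum.cong refl)
    fix i assume i: "i \<in> {2..Suc k}"
    then have "Suc (Suc k) + 1 - i = Suc (Suc (k + 1 - i))" "Suc k + 1 - i = Suc (k + 1 - i)"
      by auto
    then show "int (fib (Suc (Suc k) + 1 - i)) * \<epsilon> i \<omega>
      = int (fib (Suc k + 1 - i)) * \<epsilon> i \<omega> + int (fib (k + 1 - i)) * \<epsilon> i \<omega>"
      by (simp add: algebra_simps)
  qed
  \<comment> \<open>The extra term \<open>i = k + 1\<close> has the weight \<open>F\<^sub>0 = 0\<close>.\<close>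
  also have "(\<Sum>i\<in>{2..Suc k}. int (fib (k + 1 - i)) * \<epsilon> i \<omega>)
      = (\<Sum>i\<in>{2..k}. int (fib (k + 1 - i)) * \<epsilon> i \<omega>)"
    by (cases "k = 0") (simp_all add: sum.nat_ivl_Suc')
  finally have "S (Suc (Suc k)) = S (Suc k) + S k + \<epsilon> (Suc (Suc k)) \<omega>"
    by (simp add: S_def)
  with 3 show ?case
    unfolding S_def[symmetric]
    by (simp only: fib_process.simps) (metis mod_add_eq mod_add_left_eq)
qed simp_all

context prob_space
begin

text \<open>
  The three prescribed probabilities sum to \<open>1\<close>, so almost surely the noise takes no other value.
\<close>

lemma expectation_add_char_noise:
  fixes e :: "'a \<Rightarrow> int"
  assumes meas: "e \<in> measurable M (count_space UNIV)"
    and law: "\<And>v. v \<in> {0, 1, -1} \<Longrightarrow> \<P>(\<omega> in M. e \<omega> = v) = 1 / 3"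
  shows "expectation (\<lambda>\<omega>. add_char n a (x * e \<omega>)) = of_real (noise_factor n a x)"
proof -
  note [measurable] = meas
  let ?E = "\<lambda>v. {\<omega> \<in> space M. e \<omega> = v}"
  have ev: "?E v \<in> events" for v by measurable
  have "prob (\<Union>v\<in>{0, 1, -1}. ?E v) = (\<Sum>v\<in>{0, 1, -1}. prob (?E v))"
    using ev by (intro finite_measure_finite_Union) (auto simp: disjoint_family_on_def)
  also have "\<dots> = 1" using law[of 0] law[of 1] law[of "- 1"] by simp
  finally have "AE \<omega> in M. \<omega> \<in> (\<Union>v\<in>{0, 1, -1}. ?E v)"
    using ev by (subst prob_eq_1[symmetric]) auto
  then have ae: "AE \<omega> in M. e \<omega> \<in> {0, 1, -1}"
    by eventually_elim auto
  let ?t = "2 * pi * real a * real_of_int x / real n"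
  have "expectation (\<lambda>\<omega>. add_char n a (x * e \<omega>))
      = expectation (\<lambda>\<omega>. \<Sum>v\<in>{0, 1, -1}. indicator (?E v) \<omega> *\<^sub>R add_char n a (x * v))"
  proof (rule integral_cong_AE)
    show "AE \<omega> in M. add_char n a (x * e \<omega>)
        = (\<Sum>v\<in>{0, 1, -1}. indicator (?E v) \<omega> *\<^sub>R add_char n a (x * v))"
      using ae AE_space by eventually_elim (auto simp: indicator_def)
  qed measurable
  also have "\<dots> = (\<Sum>v\<in>{0, 1, -1}. expectation (\<lambda>\<omega>. indicator (?E v) \<omega> *\<^sub>R add_char n a (x * v)))"
    using ev by (intro Bochner_Integration.integral_sum) (auto simp: emeasure_eq_measure)
  also have "\<dots> = (\<Sum>v\<in>{0, 1, -1}. (1 / 3) *\<^sub>R add_char n a (x * v))"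
    using ev law by (intro sum.cong refl) (simp add: emeasure_eq_measure)
  also have "\<dots> = of_real (noise_factor n a x)"
    by (simp add: complex_eq_iff add_char_def noise_factor_def)
  finally show ?thesis .
qed

lemma expectation_eq_sum_prob:
  fixes X :: "'a \<Rightarrow> int" and g :: "int \<Rightarrow> complex"
  assumes meas: "X \<in> measurable M (count_space UNIV)"
    and J: "finite J" "\<And>\<omega>. X \<omega> \<in> J"
  shows "expectation (\<lambda>\<omega>. g (X \<omega>)) = (\<Sum>j\<in>J. of_real (\<P>(\<omega> in M. X \<omega> = j)) * g j)"
proof -
  note [measurable] = meas
  let ?E = "\<lambda>v. {\<omega> \<in> space M. X \<omega> = v}"
  have ev: "?E v \<in> events" for v by measurable
  have "expectation (\<lambda>\<omega>. g (X \<omega>)) = expectation (\<lambda>\<omega>. \<Sum>v\<in>J. indicator (?E v) \<omega> *\<^sub>R g v)"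
  proof (intro Bochner_Integration.integral_cong refl)
    fix \<omega> assume "\<omega> \<in> space M"
    then have "(\<Sum>v\<in>J. indicator (?E v) \<omega> *\<^sub>R g v) = (\<Sum>v\<in>J. if X \<omega> = v then g v else 0)"
      by (intro sum.cong refl) (simp add: indicator_def)
    then show "g (X \<omega>) = (\<Sum>v\<in>J. indicator (?E v) \<omega> *\<^sub>R g v)"
      using J by simp
  qed
  also have "\<dots> = (\<Sum>v\<in>J. expectation (\<lambda>\<omega>. indicator (?E v) \<omega> *\<^sub>R g v))"
    using ev by (intro Bochner_Integration.integral_sum) (auto simp: emeasure_eq_measure)
  also have "\<dots> = (\<Sum>j\<in>J. of_real (prob (?E j)) * g j)"
    using ev by (intro sum.cong refl) (simp add: emeasure_eq_measure scaleR_conv_of_real)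
  finally show ?thesis .
qed

lemma fib_process_measurable:
  assumes "\<And>i. i \<ge> 2 \<Longrightarrow> \<epsilon> i \<in> measurable M (count_space UNIV)"
  shows "fib_process n \<epsilon> k \<in> measurable M (count_space UNIV)"
proof (induction k rule: fib.induct)
  case (3 k)
  have [measurable]: "\<epsilon> (Suc (Suc k)) \<in> measurable M (count_space UNIV)"
    using assms by simp
  note [measurable] = 3
  show ?case by simp
qed simp_all

lemma fib_law_add_char:
  assumes indep: "indep_vars (\<lambda>_. count_space UNIV) \<epsilon> {2..}"
    and law: "\<And>i v. i \<ge> 2 \<Longrightarrow> v \<in> {0, 1, -1} \<Longrightarrow> \<P>(\<omega> in M. \<epsilon> i \<omega> = v) = 1 / 3"
    and n: "n > 0"
  shows "(\<Sum>j\<in>{0..<int n}. of_real (fib_law M n \<epsilon> k j) * add_char n a j)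
    = add_char n a (int (fib k)) * of_real (\<Prod>m\<in>{1..<k}. noise_factor n a (int (fib m)))"
proof -
  have meas: "\<epsilon> i \<in> measurable M (count_space UNIV)" if "i \<ge> 2" for i
    using indep that by (auto simp: indep_vars_def)
  let ?Y = "\<lambda>i \<omega>. add_char n a (int (fib (k + 1 - i)) * \<epsilon> i \<omega>)"
  have indY: "indep_vars (\<lambda>_. borel) ?Y {2..k}"
    by (rule indep_vars_compose2[OF indep_vars_subset[OF indep]]) auto
  have intY: "integrable M (?Y i)" if "i \<in> {2..k}" for i
    using indY that by (intro integrable_const_bound[of _ 1]) (auto simp: indep_vars_def)
  have "fib_process n \<epsilon> k \<omega> \<in> {0..<int n}" for \<omega>
    using n unfolding fib_process_explicit by simp
  then have "(\<Sum>j\<in>{0..<int n}. of_real (fib_law M n \<epsilon> k j) * add_char n a j)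
      = expectation (\<lambda>\<omega>. add_char n a (fib_process n \<epsilon> k \<omega>))"
    unfolding fib_law_def
    by (intro expectation_eq_sum_prob[symmetric] fib_process_measurable meas) auto
  also have "\<dots> = expectation (\<lambda>\<omega>. add_char n a (int (fib k)) * (\<Prod>i\<in>{2..k}. ?Y i \<omega>))"
    unfolding fib_process_explicit by (simp only: add_char_mod[OF n] add_char_add add_char_sum)
  also have "\<dots> = add_char n a (int (fib k)) * (\<Prod>i\<in>{2..k}. expectation (?Y i))"
    using indep_vars_lebesgue_integral[OF _ indY intY] by simp
  also have "(\<Prod>i\<in>{2..k}. expectation (?Y i))
      = (\<Prod>i\<in>{2..k}. of_real (noise_factor n a (int (fib (k + 1 - i)))))"
    using law by (intro prod.cong refl expectation_add_char_noise meas) auto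
  also have "\<dots> = (\<Prod>m\<in>{1..<k}. of_real (noise_factor n a (int (fib m))))"
    by (rule prod.reindex_bij_witness[of _ "\<lambda>m. k + 1 - m" "\<lambda>i. k + 1 - i"]) auto
  finally show ?thesis by simp
qed

end


section \<open>The mixing bound\<close>

theorem theorem7p1:
  fixes M :: "'a measure" and \<epsilon> :: "nat \<Rightarrow> 'a \<Rightarrow> int"
    and n k :: nat and c :: real
  assumes "prob_space M"
    and "prob_space.indep_vars M (\<lambda>_. count_space UNIV) \<epsilon> {2..}"
    and "\<And>i v. i \<ge> 2 \<Longrightarrow> v \<in> {0, 1, -1} \<Longrightarrow> \<P>(\<omega> in M. \<epsilon> i \<omega> = v) = 1 / 3"
    and "n \<ge> 22"
    and "k > 0"
    and "real k = 5 * ((ln (real n))\<^sup>2 + c * ln (real n))"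
  shows "tv_dist n (fib_law M n \<epsilon> k) (unif_law n) \<le> 1.6 * exp (- c / 2)"
proof -
  interpret prob_space M by fact
  note law = fib_law_add_char[OF assms(2,3)]
  define L where "L = ln (real n)"
  have n: "n > 0" using assms(4) by simp
  have L: "3 / 2 \<le> L"
  proof -
    have "3 / 2 \<le> 4 * ln (2 :: real)" using ln2_ge_two_thirds by simp
    also have "\<dots> = ln ((2 :: real) ^ 4)" by (subst ln_realpow) simp_all
    also have "\<dots> \<le> L" unfolding L_def using assms(4) by (subst ln_le_cancel_iff) auto
    finally show ?thesis .
  qed
  define i where "i = nat \<lceil>log 2 (real n)\<rceil>"
  have log_nonneg: "0 \<le> log 2 (real n)" using n by simp
  have i: "n \<le> 2 ^ i"
  proof -
    have "log 2 (real n) \<le> real i"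
      unfolding i_def by linarith
    then have "real n \<le> 2 powr real i"
      using n by (simp add: log_le_iff)
    then show ?thesis by (simp add: powr_realpow flip: of_nat_le_iff)
  qed
  define W where "W = 4 * i + 2"
  have W: "real W \<le> 10 * L"
  proof -
    have "real i \<le> log 2 (real n) + 1"
      unfolding i_def using log_nonneg by linarith
    also have "log 2 (real n) \<le> 3 / 2 * L"
    proof -
      have "L * (2 / 3) \<le> L * ln 2"
        using L ln2_ge_two_thirds by (intro mult_left_mono) auto
      then show ?thesis by (simp add: log_def field_simps flip: L_def)
    qed
    finally show ?thesis using L unfolding W_def by simp
  qed
  \<comment> \<open>The number of disjoint windows that fit among the indices \<open>1, \<dots>, k - 1\<close>.\<close>
  define N where "N = (k - 1) div W"
  have "W > 0" by (simp add: W_def)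
  have kL: "real k = 5 * (L * (L + c))"
    using assms(6) by (simp add: L_def power2_eq_square algebra_simps)
  have Lc: "0 < L + c"
    using kL L \<open>k > 0\<close> by (metis of_nat_0_less_iff zero_less_mult_iff zero_less_numeral
        less_le_trans divide_pos_pos not_less_iff_gr_or_eq)
  have N: "L + c \<le> 2 * (real N + 1)"
  proof -
    have "k \<le> (N + 1) * W"
      using dividend_less_div_times[OF \<open>W > 0\<close>, of "k - 1"] unfolding N_def by simp
    then have "real k \<le> (real N + 1) * real W"
      by (metis of_nat_1 of_nat_add of_nat_le_iff of_nat_mult)
    also have "\<dots> \<le> (real N + 1) * (10 * L)"
      using W by (intro mult_left_mono) auto
    finally show ?thesis using L by (simp add: kL)
  qed
  have "(2 * tv_dist n (fib_law M n \<epsilon> k) (unif_law n))\<^sup>2 \<le> real n * ((1 / 3) ^ N)\<^sup>2"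
  proof (rule tv_dist_unif_fourier_bound[OF n])
    show "(\<Sum>j\<in>{0..<int n}. fib_law M n \<epsilon> k j) = 1"
    proof -
      \<comment> \<open>The total mass is the Fourier coefficient at frequency \<open>0\<close>.\<close>
      have "(\<Sum>j\<in>{0..<int n}. complex_of_real (fib_law M n \<epsilon> k j)) = 1"
        using law[of n k 0] n by (simp add: noise_factor_def)
      then show ?thesis by (simp flip: of_real_sum)
    qed
  next
    fix a assume a: "0 < a" "a < n"
    have "norm (\<Sum>j\<in>{0..<int n}. of_real (fib_law M n \<epsilon> k j) * add_char n a j)
        = (\<Prod>m\<in>{1..<k}. \<bar>noise_factor n a (int (fib m))\<bar>)"
      using n by (simp only: law norm_mult norm_add_char norm_of_real abs_prod mult_1_left)
    also have "\<dots> \<le> (1 / 3) ^ N"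
    proof (rule prod_le_power_windows[where W = W])
      show "1 + N * W \<le> k"
        using \<open>k > 0\<close> div_times_less_eq_dividend[of "k - 1" W] unfolding N_def by linarith
    qed (use abs_noise_factor_le_1 fib_window_noise_factor[OF a i] in \<open>auto simp: W_def\<close>)
    finally show "norm (\<Sum>j\<in>{0..<int n}. of_real (fib_law M n \<epsilon> k j) * add_char n a j) \<le> (1 / 3) ^ N" .
  qed
  also have "\<dots> \<le> (3 * exp (- c / 2))\<^sup>2"
  proof -
    have "exp L = real n" using n by (simp add: L_def)
    have "exp (L + c) \<le> exp (2 * (real N + 1))"
      using N by simp
    also have "\<dots> = (exp 1 ^ (N + 1))\<^sup>2"
      using exp_of_nat_mult[of "N + 1" "1 :: real"] by (simp only: exp_double) (simp add: add.commute)
    also have "\<dots> \<le> (3 ^ (N + 1))\<^sup>2"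
      using exp_le by (intro power_mono) auto
    finally have "real n * exp c \<le> 9 * (3 ^ N)\<^sup>2"
      using \<open>exp L = real n\<close> by (simp add: exp_add power_mult_distrib)
    then have "real n * ((1 / 3) ^ N)\<^sup>2 \<le> 9 * exp (- c)"
      by (simp add: power_one_over field_simps exp_minus)
    also have "\<dots> = (3 * exp (- c / 2))\<^sup>2"
      by (simp add: power_mult_distrib exp_double[symmetric])
    finally show ?thesis .
  qed
  finally have "2 * tv_dist n (fib_law M n \<epsilon> k) (unif_law n) \<le> 3 * exp (- c / 2)"
    by (rule power2_le_imp_le) simp
  then have "tv_dist n (fib_law M n \<epsilon> k) (unif_law n) \<le> 1.5 * exp (- c / 2)"
    by simp
  also have "\<dots> \<le> 1.6 * exp (- c / 2)" by simp
  finally show ?thesis .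
qed

end
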